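(* Let $k\ge1$, $d\ge0$, and $L=\lfloor\log_2(d+k)\rfloor$. Then the number $\mathcal S_k(d)$ of spikes of degree $d$ in $k$ variables satisfies $$\mathcal S_k(d)=\sum_{\substack{c_0,\ldots,c_L\ge0\\ \sum_m c_m=k,\ \sum_m2^mc_m=d+k}}\frac{k!}{\prod_m c_m!},$$ and $$\operatorname{rank}M(k,d)\le N_k(d)-\mathcal S_k(d).$$
   Context: $\mathbb N$ includes $0$. $\mathcal P_k=\mathbb F_2[x_1,\dots,x_k]$ with $\deg x_i=1$; $\mathcal P_k^n$ is the degree-$n$ part and $N_k(n)=\dim\mathcal P_k^n$. For $e\in\mathbb N^k$, $x^e=\prod x_i^{e_i}$, $|e|=\sum e_i$. Steenrod squares act linearly by $\mathrm{Sq}^r(x^a)=\sum_{b\in\mathbb N^k,|b|=r}\prod_i\binom{a_i}{b_i}x^{a+b}$ (mod 2). The hit matrix $M(k,d)$ is the matrix, in monomial bases, of $\bigoplus_{t\ge0,\,2^t\le d}\mathcal P_k^{d-2^t}\to\mathcal P_k^d$, $(g_t)_t\mapsto\sum_t\mathrm{Sq}^{2^t}(g_t)$. A monomial $x^b$ in $k$ variables is a spike if each $b_i=2^{m_i}-1$ for an integer $m_i\ge0$ (zero exponents allowed). The sum is over tuples of integers $c_0,\dots,c_L\geq 0$, with $m$ running over $0,\dots,L$. *)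

theory Defs
  imports
    Complex_Main
    "HOL-Library.FuncSet"
    "HOL-Library.Z2"
    "HOL-Library.Poly_Mapping"
    "Jordan_Normal_Form.DL_Rank"
begin

text \<open>
  Multivariate polynomials over the field with two elements: finitely supported maps from
  exponents to coefficients. The variables of the polynomial ring in \<open>k\<close> variables are indexed
  by \<open>0, \<dots>, k - 1\<close>.
\<close>

type_synonym expo = "nat \<Rightarrow>\<^sub>0 nat"

type_synonym f2_poly = "expo \<Rightarrow>\<^sub>0 bit"

definition expos :: "nat \<Rightarrow> nat \<Rightarrow> expo set" where
  "expos k n = {e. Poly_Mapping.keys e \<subseteq> {..<k} \<and> (\<Sum>i<k. Poly_Mapping.lookup e i) = n}"

definition xpow :: "expo \<Rightarrow> f2_poly" where
  "xpow e = Poly_Mapping.single e 1"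

definition homog :: "nat \<Rightarrow> nat \<Rightarrow> f2_poly set" where
  "homog k n = {p. Poly_Mapping.keys p \<subseteq> expos k n}"

definition scale_poly :: "bit \<Rightarrow> f2_poly \<Rightarrow> f2_poly" where
  "scale_poly c p = Poly_Mapping.single 0 c * p"

global_interpretation f2: vector_space scale_poly
proof
  fix a b :: bit and p q :: f2_poly
  show "scale_poly a (p + q) = scale_poly a p + scale_poly a q"
    by (simp only: scale_poly_def distrib_left)
  show "scale_poly (a + b) p = scale_poly a p + scale_poly b p"
    by (simp only: scale_poly_def single_add distrib_right)
  show "scale_poly a (scale_poly b p) = scale_poly (a * b) p"
    by (simp only: scale_poly_def mult_single mult.assoc[symmetric] add_0)
  show "scale_poly 1 p = p"
    by (simp only: scale_poly_def single_one mult_1)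
qed

definition N_dim :: "nat \<Rightarrow> nat \<Rightarrow> nat" where
  "N_dim k n = f2.dim (homog k n)"

text \<open>The action on monomials given by the Cartan formula and \<open>Sq\<^sup>i (x\<^sup>a) = (a choose i) x\<^sup>a\<^sup>+\<^sup>i\<close>
  in one variable; terms with some \<open>b\<^sub>i > a\<^sub>i\<close> vanish.\<close>

definition Sq_mono :: "nat \<Rightarrow> nat \<Rightarrow> expo \<Rightarrow> f2_poly" where
  "Sq_mono k r a =
    (\<Sum>b\<in>expos k r.
      scale_poly (\<Prod>i<k. of_nat (Poly_Mapping.lookup a i choose Poly_Mapping.lookup b i))
        (xpow (a + b)))"

definition Sq :: "nat \<Rightarrow> nat \<Rightarrow> f2_poly \<Rightarrow> f2_poly" where
  "Sq k r p = (\<Sum>a\<in>Poly_Mapping.keys p. scale_poly (Poly_Mapping.lookup p a) (Sq_mono k r a))"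

text \<open>An element of the direct sum is a family \<open>g\<close> whose values \<open>g t\<close> for \<open>2 ^ t > d\<close> are ignored.\<close>

definition hit_map :: "nat \<Rightarrow> nat \<Rightarrow> (nat \<Rightarrow> f2_poly) \<Rightarrow> f2_poly" where
  "hit_map k d g = (\<Sum>t | 2 ^ t \<le> d. Sq k (2 ^ t) (g t))"

text \<open>
  Rows and columns follow the library's linear order on exponents, the columns being grouped
  by the summand \<open>t\<close> that the basis monomial belongs to.
\<close>

definition hit_rows :: "nat \<Rightarrow> nat \<Rightarrow> expo list" where
  "hit_rows k d = sorted_list_of_set (expos k d)"

definition hit_cols :: "nat \<Rightarrow> nat \<Rightarrow> (nat \<times> expo) list" where
  "hit_cols k d =
    concat (map (\<lambda>t. map (Pair t) (sorted_list_of_set (expos k (d - 2 ^ t))))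
      (sorted_list_of_set {t. 2 ^ t \<le> d}))"

definition sum_basis :: "nat \<times> expo \<Rightarrow> nat \<Rightarrow> f2_poly" where
  "sum_basis = (\<lambda>(t, e) s. if s = t then xpow e else 0)"

definition hit_matrix :: "nat \<Rightarrow> nat \<Rightarrow> bit mat" where
  "hit_matrix k d =
    mat (length (hit_rows k d)) (length (hit_cols k d))
      (\<lambda>(i, j). Poly_Mapping.lookup (hit_map k d (sum_basis (hit_cols k d ! j))) (hit_rows k d ! i))"

text \<open>The rank in \<^locale>\<open>vec_space\<close> is parametrised by the number of rows.\<close>

definition hit_rank :: "nat \<Rightarrow> nat \<Rightarrow> nat" where
  "hit_rank k d = vec_space.rank (dim_row (hit_matrix k d)) (hit_matrix k d)"

definition is_spike :: "nat \<Rightarrow> f2_poly \<Rightarrow> bool" where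
  "is_spike k p \<longleftrightarrow>
    (\<exists>b. Poly_Mapping.keys b \<subseteq> {..<k} \<and> p = xpow b \<and>
      (\<forall>i<k. \<exists>m. Poly_Mapping.lookup b i = 2 ^ m - 1))"

definition spike_count :: "nat \<Rightarrow> nat \<Rightarrow> nat" where
  "spike_count k d = card {p \<in> homog k d. is_spike k p}"

text \<open>The tuples \<open>(c 0, \<dots>, c L)\<close> are the functions on \<open>{..L}\<close>, taken to be undefined elsewhere.\<close>

definition spike_types :: "nat \<Rightarrow> nat \<Rightarrow> nat \<Rightarrow> (nat \<Rightarrow> nat) set" where
  "spike_types k d L =
    {c \<in> {..L} \<rightarrow>\<^sub>E UNIV. (\<Sum>m\<le>L. c m) = k \<and> (\<Sum>m\<le>L. 2 ^ m * c m) = d + k}"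

end

theory Submission
  imports Defs "HOL-Combinatorics.Multiset_Permutations"
begin

text \<open>
  The rank bound rests on the fact that no positive Steenrod square ever produces a spike. By the
  Cartan formula, the coefficient of \<open>x\<^sup>e\<close> in \<open>Sq\<^sup>r (x\<^sup>a)\<close> is, for \<open>a + b = e\<close>, a product of
  the binomial coefficients \<open>a\<^sub>i choose b\<^sub>i\<close>. If \<open>r > 0\<close> then some \<open>b\<^sub>i\<close> is positive, and if
  \<open>a\<^sub>i + b\<^sub>i = 2\<^sup>m - 1\<close>, the binary digits of \<open>b\<^sub>i\<close> are complementary to those of \<open>a\<^sub>i\<close> and hence
  not among them, so that \<open>a\<^sub>i choose b\<^sub>i\<close> is even (\<open>even_binomial_sum_mersenne\<close>). The rows of the
  hit matrix that belong to spikes are therefore zero (\<open>lookup_hit_map_spike\<close>). A matrix has rank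
  at most the number of its nonzero rows (\<open>rank_le_card_nonzero_rows\<close>), and the monomials of
  degree \<open>d\<close>, which index all rows, form a basis of the space whose dimension is \<open>N_dim k d\<close>.

  For the count, a spike with exponents \<open>2\<^sup>m - 1\<close> for \<open>m = m\<^sub>1, \<dots>, m\<^sub>k\<close> has degree \<open>d\<close> exactly
  when the powers \<open>2\<^sup>m\<close> add up to \<open>d + k\<close>; so spikes correspond to words of length \<open>k\<close> with this
  sum (\<open>card_spike_expos\<close>). Each such \<open>m\<close> is at most \<open>L\<close> because \<open>d + k < 2\<^sup>L\<^sup>+\<^sup>1\<close>. Sorting the
  words by the number \<open>c m\<close> of occurrences of each letter \<open>m\<close> splits them into classes, one for
  each tuple \<open>c\<close> in the sum, and the class of \<open>c\<close> consists of the permutations of one multiset,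
  whose number is the multinomial coefficient.
\<close>

section \<open>Parity of binomial coefficients\<close>

text \<open>
  The absorption identity makes \<open>k * (n choose k)\<close> a multiple of the even number \<open>n\<close>, and the odd
  factor \<open>k\<close> can be cancelled.
\<close>

lemma even_binomial_even_odd:
  fixes n k :: nat
  assumes "even n" "odd k"
  shows "even (n choose k)"
proof (cases n)
  case 0
  then show ?thesis using assms(2) by (cases k) auto
next
  case (Suc n')
  obtain k' where k: "k = Suc k'" using assms(2) by (cases k) auto
  have "even (k * (n choose k))"
    using Suc_times_binomial_eq[of n' k'] assms(1) Suc k by (metis even_mult_iff mult.commute)
  then show ?thesis using assms(2) by simp
qed

text \<open>
  This is the step of Lucas' theorem modulo 2 that drops a common last binary digit 0. Applying
  Pascal's rule twice to the doubled coefficient leaves, modulo 2, Pascal's rule for \<open>n choose k\<close>.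
\<close>

lemma even_binomial_double:
  fixes n k :: nat
  shows "even ((2 * n) choose (2 * k)) \<longleftrightarrow> even (n choose k)"
proof (induction n arbitrary: k)
  case 0
  then show ?case by (cases k) auto
next
  case (Suc n)
  show ?case
  proof (cases k)
    case 0
    then show ?thesis by simp
  next
    case (Suc j)
    have "(2 * Suc n) choose (2 * Suc j) =
        ((2 * n) choose (2 * j)) + 2 * ((2 * n) choose Suc (2 * j)) + ((2 * n) choose (2 * Suc j))"
      by simp
    then have "even ((2 * Suc n) choose (2 * Suc j)) \<longleftrightarrow>
        (even ((2 * n) choose (2 * j)) \<longleftrightarrow> even ((2 * n) choose (2 * Suc j)))"
      by (simp only: even_add dvd_triv_left simp_thms)
    then show ?thesis
      unfolding Suc Suc.IH by simp
  qed
qed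

text \<open>
  The digits of \<open>a + b\<close> are all 1, so the last digits of \<open>a\<close> and \<open>b\<close> differ. If that of \<open>b\<close> is 1,
  the coefficient is even at once; otherwise it has the parity of the coefficient with both last
  digits removed, and \<open>b\<close> stays positive. Since \<open>b\<close> has a digit 1, the former case must occur.
\<close>

lemma even_binomial_sum_mersenne:
  fixes a b m :: nat
  assumes "a + b = 2 ^ m - 1" "b > 0"
  shows "even (a choose b)"
  using assms
proof (induction m arbitrary: a b)
  case 0
  then show ?case by simp
next
  case (Suc m)
  have sum: "a + b + 1 = 2 * 2 ^ m" using Suc.prems by simp
  then have par: "even a \<longleftrightarrow> odd b" by presburger
  show ?case
  proof (cases "even a")
    case True
    then show ?thesis using par even_binomial_even_odd by blast
  next
    case False
    then obtain a' b' where a: "a = 2 * a' + 1" and b: "b = 2 * b'"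
      using par by (meson evenE oddE)
    have b': "b' > 0" using b Suc.prems(2) by simp
    have "a' + b' + 1 = 2 ^ m" using sum a b by simp
    then have "even (a' choose b')" using Suc.IH[of a' b'] b' by simp
    then have e1: "even ((2 * a') choose (2 * b'))" by (simp add: even_binomial_double)
    obtain c where c: "b' = Suc c" using b' by (cases b') auto
    have e2: "even ((2 * a') choose Suc (2 * c))" by (rule even_binomial_even_odd) auto
    have "a choose b = ((2 * a') choose Suc (2 * c)) + ((2 * a') choose (2 * b'))"
      unfolding a b c by simp
    then show ?thesis using e1 e2 by simp
  qed
qed

section \<open>Spike coefficients of Steenrod squares\<close>

lemma lookup_scale_poly:
  "Poly_Mapping.lookup (scale_poly c p) e = c * Poly_Mapping.lookup p e"
  by (simp only: scale_poly_def mult_map_scale_conv_mult[symmetric] Poly_Mapping.map.rep_eq)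
    (simp add: when_def)

lemma lookup_xpow: "Poly_Mapping.lookup (xpow e) f = (1 when e = f)"
  by (simp add: xpow_def lookup_single)

text \<open>
  Identifies exponents in \<open>k\<close> variables with lists of length \<open>k\<close>, so that finiteness of \<open>expos\<close>
  can be read off from the finiteness of sets of bounded lists.
\<close>

lemma expo_eq_nth:
  assumes "Poly_Mapping.keys e \<subseteq> {..<k}"
  shows "e = Poly_Mapping.nth (map (Poly_Mapping.lookup e) [0..<k])"
proof (rule poly_mapping_eqI)
  fix i
  show "Poly_Mapping.lookup e i =
      Poly_Mapping.lookup (Poly_Mapping.nth (map (Poly_Mapping.lookup e) [0..<k])) i"
    using assms by (cases "i < k") (auto simp: nth_default_def in_keys_iff)
qed

lemma finite_expos: "finite (expos k n)"
proof (rule finite_subset)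
  show "expos k n \<subseteq> Poly_Mapping.nth ` {xs. set xs \<subseteq> {..n} \<and> length xs = k}"
  proof
    fix e assume e: "e \<in> expos k n"
    have "Poly_Mapping.lookup e i \<le> n" if "i < k" for i
      using member_le_sum[of i "{..<k}" "Poly_Mapping.lookup e"] that e by (simp add: expos_def)
    then show "e \<in> Poly_Mapping.nth ` {xs. set xs \<subseteq> {..n} \<and> length xs = k}"
      using e by (intro image_eqI[where x = "map (Poly_Mapping.lookup e) [0..<k]"] expo_eq_nth)
        (auto simp: expos_def)
  qed
  show "finite (Poly_Mapping.nth ` {xs. set xs \<subseteq> {..n} \<and> length xs = k})"
    by (intro finite_imageI finite_lists_length_eq) simp
qed

lemma xpow_eq_iff: "xpow e = xpow f \<longleftrightarrow> e = f"
  by (metis lookup_xpow when_def zero_neq_one)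

definition spike_expos :: "nat \<Rightarrow> nat \<Rightarrow> expo set" where
  "spike_expos k d = {e \<in> expos k d. \<forall>i<k. \<exists>m. Poly_Mapping.lookup e i = 2 ^ m - 1}"

lemma spike_count_eq_card_spike_expos: "spike_count k d = card (spike_expos k d)"
proof -
  have "{p \<in> homog k d. is_spike k p} = xpow ` spike_expos k d"
    by (auto simp: homog_def is_spike_def spike_expos_def xpow_def expos_def)
  moreover have "inj_on xpow (spike_expos k d)"
    by (simp add: inj_on_def xpow_eq_iff)
  ultimately show ?thesis
    by (simp add: spike_count_def card_image)
qed

text \<open>
  Only \<open>b = e - a\<close> contributes to the coefficient of \<open>x\<^sup>e\<close>; as \<open>b\<close> has positive degree, it is
  positive in some variable, and the factor belonging to that variable vanishes modulo 2.
\<close>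

lemma lookup_Sq_mono_spike:
  assumes "r > 0" "e \<in> spike_expos k d"
  shows "Poly_Mapping.lookup (Sq_mono k r a) e = 0"
proof -
  have "(\<Prod>i<k. of_nat (Poly_Mapping.lookup a i choose Poly_Mapping.lookup b i)) = (0 :: bit)"
    if b: "b \<in> expos k r" and ab: "a + b = e" for b
  proof -
    have "\<exists>i<k. Poly_Mapping.lookup b i > 0"
      using b \<open>r > 0\<close> by (auto simp: expos_def intro: ccontr)
    then obtain i where i: "i < k" "Poly_Mapping.lookup b i > 0" by blast
    obtain m where "Poly_Mapping.lookup e i = 2 ^ m - 1"
      using assms(2) i(1) by (auto simp: spike_expos_def)
    then have "Poly_Mapping.lookup a i + Poly_Mapping.lookup b i = 2 ^ m - 1"
      using ab by (auto simp: lookup_add)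
    then have "even (Poly_Mapping.lookup a i choose Poly_Mapping.lookup b i)"
      using i(2) by (rule even_binomial_sum_mersenne)
    then have "(of_nat (Poly_Mapping.lookup a i choose Poly_Mapping.lookup b i) :: bit) = 0"
      by (auto elim!: evenE)
    then show ?thesis using i(1) by (auto intro!: prod_zero)
  qed
  then show ?thesis
    unfolding Sq_mono_def lookup_sum lookup_scale_poly lookup_xpow
    by (intro sum.neutral ballI) (auto simp: when_def)
qed

lemma lookup_hit_map_spike:
  assumes "e \<in> spike_expos k d'"
  shows "Poly_Mapping.lookup (hit_map k d g) e = 0"
  by (simp add: hit_map_def Sq_def lookup_sum lookup_scale_poly lookup_Sq_mono_spike[OF _ assms])

section \<open>Rank and zero rows\<close>

text \<open>
  The columns lie in the span of the unit vectors whose index is in \<open>I\<close>, so by the exchange lemma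
  no more than \<open>card I\<close> of them are linearly independent.
\<close>

lemma (in vec_space) rank_le_card_nonzero_rows:
  assumes A: "A \<in> carrier_mat n nc"
    and I: "I \<subseteq> {..<n}"
    and zero: "\<And>i j. i < n \<Longrightarrow> i \<notin> I \<Longrightarrow> j < nc \<Longrightarrow> A $$ (i, j) = 0"
  shows "rank A \<le> card I"
proof -
  define U :: "'a vec set" where "U = unit_vec n ` I"
  have finI: "finite I" using I finite_subset by blast
  then have finU: "finite U" by (simp add: U_def)
  have U: "U \<subseteq> carrier_vec n" by (auto simp: U_def)
  have inj: "inj_on (unit_vec n :: nat \<Rightarrow> 'a vec) I"
    using I by (auto simp: inj_on_def)
  have cols: "set (cols A) \<subseteq> span U"
  proof
    fix v assume "v \<in> set (cols A)"
    then obtain j where j: "j < nc" and v: "v = col A j"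
      using A by (auto simp: cols_def)
    have dimv: "v \<in> carrier_vec n" using A v by auto
    \<comment> \<open>\<open>lincomb\<close> takes its coefficients as a function of the vectors, hence the index of a unit
      vector has to be recovered from the vector.\<close>
    define a where "a u = v $ (THE i. u = unit_vec n i)" for u :: "'a vec"
    have a: "a (unit_vec n i) = v $ i" if "i < n" for i
    proof -
      have "(THE i'. (unit_vec n i :: 'a vec) = unit_vec n i') = i"
        using that by (auto intro!: the_equality)
      then show ?thesis by (simp add: a_def)
    qed
    have "v = lincomb a U"
    proof (rule eq_vecI)
      show "dim_vec v = dim_vec (lincomb a U)" using lincomb_dim[OF finU U] dimv by auto
      fix i assume "i < dim_vec (lincomb a U)"
      then have i: "i < n" using lincomb_dim[OF finU U] by auto
      have "lincomb a U $ i = (\<Sum>i'\<in>I. a (unit_vec n i') * unit_vec n i' $ i)"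
        unfolding lincomb_index[OF i U] unfolding U_def by (simp add: sum.reindex[OF inj])
      also have "\<dots> = (\<Sum>i'\<in>I. if i' = i then v $ i else 0)"
        using I i by (intro sum.cong) (auto simp: a)
      also have "\<dots> = (if i \<in> I then v $ i else 0)" using finI by simp
      also have "\<dots> = v $ i" using zero[OF i _ j] A v i j by auto
      finally show "v $ i = lincomb a U $ i" by simp
    qed
    then show "v \<in> span U" using finU by blast
  qed
  obtain S where S: "maximal S (\<lambda>T. T \<subseteq> set (cols A) \<and> lin_indpt T)" "finite S"
    using maximal_exists_superset[of "set (cols A)" "\<lambda>T. T \<subseteq> set (cols A) \<and> lin_indpt T" "{}"]
      finite_lin_indpt2[of "{}"] by auto
  then have S': "S \<subseteq> span U" "lin_indpt S" using cols by (auto simp: maximal_def)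
  obtain C :: "'a vec set" where "int (card C) \<le> int (card U) - int (card S)"
    using replacement[OF S(2) finU _ S'(2) S'(1)] U by auto
  then have "card S \<le> card U" by linarith
  also have "\<dots> \<le> card I" using finI by (simp add: U_def card_image_le)
  finally show ?thesis using rank_card_indpt[OF A S(1)] by simp
qed

lemma hit_rank_le: "hit_rank k d \<le> card (expos k d - spike_expos k d)"
proof -
  let ?n = "length (hit_rows k d)"
  define I where "I = {i. i < ?n \<and> hit_rows k d ! i \<notin> spike_expos k d}"
  have rows: "distinct (hit_rows k d)" "set (hit_rows k d) = expos k d"
    by (simp_all add: hit_rows_def finite_expos)
  have "vec_space.rank ?n (hit_matrix k d) \<le> card I"
  proof (rule vec_space.rank_le_card_nonzero_rows)
    show "hit_matrix k d \<in> carrier_mat ?n (length (hit_cols k d))"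
      by (simp add: hit_matrix_def)
    show "I \<subseteq> {..<?n}" by (auto simp: I_def)
    show "hit_matrix k d $$ (i, j) = 0"
      if "i < ?n" "i \<notin> I" "j < length (hit_cols k d)" for i j
      using that lookup_hit_map_spike[of "hit_rows k d ! i" k d] by (simp add: hit_matrix_def I_def)
  qed
  also have "card I = card ((!) (hit_rows k d) ` I)"
    using rows(1) by (intro card_image[symmetric]) (auto simp: inj_on_def I_def nth_eq_iff_index_eq)
  also have "(!) (hit_rows k d) ` I = expos k d - spike_expos k d"
    unfolding rows(2)[symmetric] I_def by (auto simp: in_set_conv_nth)
  finally show ?thesis by (simp add: hit_rank_def hit_matrix_def)
qed

lemma N_dim_eq_card_expos: "N_dim k n = card (expos k n)"
proof -
  have inj: "inj_on xpow (expos k n)" by (simp add: inj_on_def xpow_eq_iff)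
  have lookup: "Poly_Mapping.lookup (\<Sum>e\<in>expos k n. scale_poly (u e) (xpow e)) f =
      (if f \<in> expos k n then u f else 0)" for u f
  proof -
    have "Poly_Mapping.lookup (\<Sum>e\<in>expos k n. scale_poly (u e) (xpow e)) f =
        (\<Sum>e\<in>expos k n. if e = f then u f else 0)"
      unfolding lookup_sum lookup_scale_poly lookup_xpow
      by (intro sum.cong) auto
    then show ?thesis using finite_expos by simp
  qed
  have "card (xpow ` expos k n) = f2.dim (homog k n)"
  proof (rule f2.basis_card_eq_dim)
    show "xpow ` expos k n \<subseteq> homog k n"
      by (auto simp: homog_def xpow_def)
    show "homog k n \<subseteq> f2.span (xpow ` expos k n)"
    proof
      fix p assume "p \<in> homog k n"
      then have "p = (\<Sum>e\<in>expos k n. scale_poly (Poly_Mapping.lookup p e) (xpow e))"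
        by (intro poly_mapping_eqI)
          (auto simp: lookup homog_def in_keys_iff simp del: bit_not_zero_iff)
      also have "\<dots> \<in> f2.span (xpow ` expos k n)"
        by (intro f2.span_sum f2.span_scale f2.span_base) auto
      finally show "p \<in> f2.span (xpow ` expos k n)" .
    qed
    show "f2.independent (xpow ` expos k n)"
    proof (rule f2.independent_if_scalars_zero)
      show "finite (xpow ` expos k n)" by (simp add: finite_expos)
      fix u x
      assume sum: "(\<Sum>x\<in>xpow ` expos k n. scale_poly (u x) x) = 0" and "x \<in> xpow ` expos k n"
      then obtain f where f: "f \<in> expos k n" "x = xpow f" by blast
      have "(\<Sum>e\<in>expos k n. scale_poly (u (xpow e)) (xpow e)) = 0"
        using sum by (simp add: sum.reindex[OF inj])
      then show "u x = 0"
        using lookup[of "\<lambda>e. u (xpow e)" f] f by simp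
    qed
  qed
  then show ?thesis by (simp add: N_dim_def card_image[OF inj])
qed

section \<open>Counting spikes\<close>

definition spike_lists :: "nat \<Rightarrow> nat \<Rightarrow> nat list set" where
  "spike_lists k d = {xs. length xs = k \<and> (\<Sum>m\<leftarrow>xs. 2 ^ m) = d + k}"

text \<open>
  Adding 1 to each of the \<open>k\<close> exponents turns a spike of degree \<open>d\<close> into a sequence of powers of 2
  with sum \<open>d + k\<close>. The map is injective because a power of 2 determines its exponent.
\<close>

lemma card_spike_expos: "card (spike_expos k d) = card (spike_lists k d)"
proof -
  define f where "f xs = Poly_Mapping.nth (map (\<lambda>m. 2 ^ m - 1 :: nat) xs)" for xs
  have lookup_f: "Poly_Mapping.lookup (f xs) i = (if i < length xs then 2 ^ (xs ! i) - 1 else 0)"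
    for xs i
    by (simp add: f_def nth_default_def)
  have degree: "(\<Sum>i<k. Poly_Mapping.lookup (f xs) i) + k = (\<Sum>m\<leftarrow>xs. 2 ^ m)"
    if "length xs = k" for xs
  proof -
    have "(\<Sum>i<k. Poly_Mapping.lookup (f xs) i) + k =
        (\<Sum>i<k. Poly_Mapping.lookup (f xs) i + 1)"
      by (simp only: sum.distrib) simp
    also have "\<dots> = (\<Sum>i<k. 2 ^ (xs ! i))"
      using that by (intro sum.cong) (auto simp: lookup_f)
    also have "\<dots> = (\<Sum>m\<leftarrow>xs. 2 ^ m)"
      using that by (simp add: sum_list_sum_nth atLeast0LessThan)
    finally show ?thesis .
  qed
  have "bij_betw f (spike_lists k d) (spike_expos k d)"
  proof (rule bij_betwI')
    fix xs ys assume xs: "xs \<in> spike_lists k d" and ys: "ys \<in> spike_lists k d"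
    show "f xs = f ys \<longleftrightarrow> xs = ys"
    proof
      assume eq: "f xs = f ys"
      show "xs = ys"
      proof (rule nth_equalityI)
        show "length xs = length ys" using xs ys by (simp add: spike_lists_def)
        fix i assume "i < length xs"
        then have "(2::nat) ^ (xs ! i) - 1 = 2 ^ (ys ! i) - 1"
          using arg_cong[OF eq, of "\<lambda>e. Poly_Mapping.lookup e i"] xs ys
          by (simp add: lookup_f spike_lists_def)
        then have "(2::nat) ^ (xs ! i) = 2 ^ (ys ! i)"
          by (simp add: eq_diff_iff)
        then show "xs ! i = ys ! i" by simp
      qed
    qed simp
  next
    fix xs assume xs: "xs \<in> spike_lists k d"
    then show "f xs \<in> spike_expos k d"
      using degree[of xs]
      by (auto simp: spike_expos_def expos_def spike_lists_def lookup_f in_keys_iff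
        simp del: keys_nth split: if_splits)
  next
    fix e assume e: "e \<in> spike_expos k d"
    then obtain m where m: "\<And>i. i < k \<Longrightarrow> Poly_Mapping.lookup e i = 2 ^ m i - 1"
      unfolding spike_expos_def by (auto; metis)
    have e_eq: "e = f (map m [0..<k])"
    proof (rule poly_mapping_eqI)
      fix i
      show "Poly_Mapping.lookup e i = Poly_Mapping.lookup (f (map m [0..<k])) i"
        using e by (cases "i < k") (auto simp: lookup_f m spike_expos_def expos_def in_keys_iff)
    qed
    have "map m [0..<k] \<in> spike_lists k d"
      using degree[of "map m [0..<k]"] e
      by (simp add: spike_lists_def flip: e_eq) (simp add: spike_expos_def expos_def)
    then show "\<exists>xs\<in>spike_lists k d. e = f xs" using e_eq by blast
  qed
  then show ?thesis by (simp add: bij_betw_same_card)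
qed

definition type_mset :: "nat \<Rightarrow> (nat \<Rightarrow> nat) \<Rightarrow> nat multiset" where
  "type_mset L c = (\<Sum>m\<le>L. replicate_mset (c m) m)"

lemma count_type_mset: "count (type_mset L c) m = (if m \<le> L then c m else 0)"
proof -
  have "count (type_mset L c) m = (\<Sum>x\<le>L. if x = m then c m else 0)"
    unfolding type_mset_def count_sum by (intro sum.cong) auto
  then show ?thesis by simp
qed

lemma sum_mset_type_mset:
  fixes h :: "nat \<Rightarrow> nat"
  shows "(\<Sum>m\<in>#type_mset L c. h m) = (\<Sum>m\<le>L. h m * c m)"
  unfolding type_mset_def by (induction L) (auto simp: mult.commute)

lemma size_type_mset: "size (type_mset L c) = (\<Sum>m\<le>L. c m)"
  unfolding type_mset_def by (induction L) auto

text \<open>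
  \<open>card_permutations_of_multiset_aux\<close> has a product over the support of the multiset; the letters
  \<open>m \<le> L\<close> outside the support contribute the factor \<open>fact 0 = 1\<close>.
\<close>

lemma card_permutations_type_mset:
  "real (card (permutations_of_multiset (type_mset L c))) =
    fact (\<Sum>m\<le>L. c m) / (\<Prod>m\<le>L. fact (c m))"
proof -
  have "(\<Prod>m\<in>set_mset (type_mset L c). fact (count (type_mset L c) m)) =
      (\<Prod>m\<le>L. fact (c m) :: nat)"
    by (intro prod.mono_neutral_cong_left)
      (auto simp: count_type_mset set_mset_def split: if_splits intro: gr0I)
  then have "card (permutations_of_multiset (type_mset L c)) * (\<Prod>m\<le>L. fact (c m)) =
      fact (\<Sum>m\<le>L. c m)"
    using card_permutations_of_multiset_aux[of "type_mset L c"] by (simp add: size_type_mset)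
  then have "real (card (permutations_of_multiset (type_mset L c))) * (\<Prod>m\<le>L. fact (c m)) =
      fact (\<Sum>m\<le>L. c m)"
    by (metis (mono_tags, lifting) of_nat_fact of_nat_mult of_nat_prod prod.cong)
  then show ?thesis
    by (simp add: field_simps)
qed

text \<open>
  The bound on \<open>d + k\<close> ensures that no letter of a word exceeds \<open>L\<close>, so that its type, a function
  on \<open>{..L}\<close>, accounts for all of its letters.
\<close>

lemma spike_lists_by_type:
  assumes "d + k < 2 ^ Suc L"
  shows "spike_lists k d = (\<Union>c\<in>spike_types k d L. permutations_of_multiset (type_mset L c))"
proof (intro equalityI subsetI)
  fix xs assume xs: "xs \<in> spike_lists k d"
  define c where "c = restrict (count (mset xs)) {..L}"
  have "m \<le> L" if "m \<in> set xs" for m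
  proof -
    have "2 ^ m \<le> (\<Sum>m\<leftarrow>xs. 2 ^ m :: nat)"
      using that by (intro member_le_sum_list) auto
    also have "\<dots> < 2 ^ Suc L" using xs assms by (simp add: spike_lists_def)
    finally have "m < Suc L" by (simp only: power_strict_increasing_iff)
    then show ?thesis by simp
  qed
  then have mset: "mset xs = type_mset L c"
    by (intro multiset_eqI) (auto simp: count_type_mset c_def count_mset count_list_0_iff)
  have c_PiE: "c \<in> {..L} \<rightarrow>\<^sub>E UNIV" by (simp add: c_def)
  then have "c \<in> spike_types k d L"
    using xs size_type_mset[of L c] sum_mset_type_mset[of "\<lambda>m. 2 ^ m" L c]
    by (simp add: spike_types_def spike_lists_def c_PiE flip: mset sum_mset_sum_list)
  then show "xs \<in> (\<Union>c\<in>spike_types k d L. permutations_of_multiset (type_mset L c))"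
    using mset by (auto simp: permutations_of_multiset_def)
next
  fix xs assume "xs \<in> (\<Union>c\<in>spike_types k d L. permutations_of_multiset (type_mset L c))"
  then obtain c where c: "c \<in> spike_types k d L" and mset: "mset xs = type_mset L c"
    by (auto simp: permutations_of_multiset_def)
  show "xs \<in> spike_lists k d"
    using c size_type_mset[of L c] sum_mset_type_mset[of "\<lambda>m. 2 ^ m" L c]
    by (auto simp: spike_types_def spike_lists_def simp flip: mset sum_mset_sum_list)
qed

lemma finite_spike_types: "finite (spike_types k d L)"
proof (rule finite_subset)
  show "spike_types k d L \<subseteq> {..L} \<rightarrow>\<^sub>E {..k}"
  proof (intro subsetI PiE_I)
    fix c m assume c: "c \<in> spike_types k d L"
    show "c m \<in> {..k}" if "m \<in> {..L}"
      using c member_le_sum[OF that, of c] by (simp add: spike_types_def)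
    show "c m = undefined" if "m \<notin> {..L}"
      using c that by (auto simp: spike_types_def dest: PiE_arb)
  qed
qed (auto intro: finite_PiE)

lemma card_spike_lists:
  assumes "d + k < 2 ^ Suc L"
  shows "real (card (spike_lists k d)) =
    (\<Sum>c\<in>spike_types k d L. fact k / (\<Prod>m\<le>L. fact (c m)))"
proof -
  have "c = c'"
    if "c \<in> spike_types k d L" "c' \<in> spike_types k d L" "type_mset L c = type_mset L c'" for c c'
  proof (rule PiE_ext)
    show "c \<in> {..L} \<rightarrow>\<^sub>E UNIV" "c' \<in> {..L} \<rightarrow>\<^sub>E UNIV"
      using that by (auto simp: spike_types_def)
    show "c m = c' m" if "m \<in> {..L}" for m
      using \<open>type_mset L c = type_mset L c'\<close> that by (metis atMost_iff count_type_mset)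
  qed
  then have "card (spike_lists k d) =
      (\<Sum>c\<in>spike_types k d L. card (permutations_of_multiset (type_mset L c)))"
    unfolding spike_lists_by_type[OF assms]
    by (intro card_UN_disjoint finite_spike_types ballI impI finite_permutations_of_multiset)
      (auto simp: permutations_of_multiset_def)
  then have "real (card (spike_lists k d)) =
      (\<Sum>c\<in>spike_types k d L. real (card (permutations_of_multiset (type_mset L c))))"
    by simp
  also have "\<dots> = (\<Sum>c\<in>spike_types k d L. fact k / (\<Prod>m\<le>L. fact (c m)))"
    by (intro sum.cong refl) (auto simp: card_permutations_type_mset spike_types_def)
  finally show ?thesis .
qed

theorem proposition3p5:
  fixes k d L :: nat
  assumes "k \<ge> 1"
    and "L = nat \<lfloor>log 2 (real (d + k))\<rfloor>"
  shows "real (spike_count k d) =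
      (\<Sum>c\<in>spike_types k d L. fact k / (\<Prod>m\<le>L. fact (c m))) \<and>
    int (hit_rank k d) \<le> int (N_dim k d) - int (spike_count k d)"
proof
  have "log 2 (real (d + k)) < real (Suc L)"
    unfolding assms(2) by linarith
  then have "real (d + k) < 2 powr real (Suc L)"
    using assms(1) by (subst (asm) log_less_iff) auto
  then have "real (d + k) < real (2 ^ Suc L)"
    by (simp only: powr_realpow) simp
  then have "d + k < 2 ^ Suc L"
    by (simp only: of_nat_less_iff)
  then show "real (spike_count k d) =
      (\<Sum>c\<in>spike_types k d L. fact k / (\<Prod>m\<le>L. fact (c m)))"
    by (simp add: spike_count_eq_card_spike_expos card_spike_expos card_spike_lists)
next
  have sub: "spike_expos k d \<subseteq> expos k d" by (auto simp: spike_expos_def)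
  then have "card (expos k d - spike_expos k d) + card (spike_expos k d) = card (expos k d)"
    using finite_expos by (metis card_Diff_subset card_mono finite_subset le_add_diff_inverse2)
  then show "int (hit_rank k d) \<le> int (N_dim k d) - int (spike_count k d)"
    using hit_rank_le[of k d] by (simp add: N_dim_eq_card_expos spike_count_eq_card_spike_expos)
qed

end
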